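(* Let $\alpha\in I[a,b]$ and $f\in B[a,b]$. Then $f\in RDS_\alpha[a,b]$ if and only if for every $\epsilon>0$ there exists a partition $\mathcal P$ of $[a,b]$ such that the best-fit step functions $\hat u,\hat v$ of $f$ with respect to $\mathcal P$ satisfy $$U_\alpha^r(f,\mathcal P)-L_\alpha^r(f,\mathcal P)=\int_a^b \hat u(x)-\hat v(x)\,d\alpha<\epsilon .$$ As a consequence, $f\in RDS_\alpha[a,b]$ if and only if $f\in RDS_\alpha^*[a,b]$ (i.e. $f$ is integrable in the sense of Ross), and in that case the two integrals agree.
   Context: Fix reals $a<b$. $B[a,b]$ and $I[a,b]$ denote the bounded and the increasing (nondecreasing) real functions on $[a,b]$. $\alpha(x\pm)$ are one-sided limits, with the convention $\alpha(a-)=\alpha(a)$, $\alpha(b+)=\alpha(b)$. A partition is $\mathcal P=\{x_i\}_{i=0}^n$ with $a=x_0<\dots<x_n=b$; $I_i=(x_{i-1},x_i)$. Set $\mu_\alpha((c,d))=\alpha(d-)-\alpha(c+)$ and $\mu_\alpha(\{c\})=\alpha(c+)-\alpha(c-)$. A step function $u\in S[a,b]$ is a bounded function which, for some partition, equals a constant $c_i$ on each $I_i$ (values at partition points arbitrary); its integral is $\int_a^b u\,d\alpha=\sum_{i=0}^n u(x_i)\mu_\alpha(\{x_i\})+\sum_{i=1}^n c_i\mu_\alpha(I_i)$ (independent of the partition). RDS integral: let $L_\alpha(f,[a,b])=\sup\{\int_a^b v\,d\alpha: v\in S[a,b], v\le f\}$ and $U_\alpha(f,[a,b])=\inf\{\int_a^b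 u\,d\alpha: u\in S[a,b], u\ge f\}$. Write $f\in RDS_\alpha[a,b]$ if these are equal; the common value is the RDS integral $\int_a^b f(x)\,d\alpha$. Best-fit step functions: with $M_i=\sup_{I_i}f$, $m_i=\inf_{I_i}f$, $\hat u=M_i$ and $\hat v=m_i$ on $I_i$, and $\hat u(x_i)=\hat v(x_i)=f(x_i)$ at each partition point. Ross's integral: with $J_\alpha(f,\mathcal P)=\sum_{i=0}^n f(x_i)[\alpha(x_i+)-\alpha(x_i-)]$, put $U_\alpha^r(f,\mathcal P)=J_\alpha(f,\mathcal P)+\sum_{i=1}^n M_i[\alpha(x_i-)-\alpha(x_{i-1}+)]$ and $L_\alpha^r(f,\mathcal P)=J_\alpha(f,\mathcal P)+\sum_{i=1}^n m_i[\alpha(x_i-)-\alpha(x_{i-1}+)]$. Then $f\in RDS^*_\alpha[a,b]$ if $\inf_{\mathcal P}U_\alpha^r(f,\mathcal P)=\sup_{\mathcal P}L_\alpha^r(f,\mathcal P)$ over all partitions of $[a,b]$, and the common value is Ross's integral of $f$. *)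

theory Defs
  imports "HOL-Analysis.Analysis"
begin

text \<open>Functions on \<open>[a,b]\<close> are represented by total functions on the reals; every notion
  below depends only on their values on \<open>{a..b}\<close>.\<close>

text \<open>One-sided limits \<open>\<alpha>(x-)\<close> and \<open>\<alpha>(x+)\<close>, with the conventions \<open>\<alpha>(a-) = \<alpha>(a)\<close> and
  \<open>\<alpha>(b+) = \<alpha>(b)\<close>.\<close>

definition left_lim :: "real \<Rightarrow> (real \<Rightarrow> real) \<Rightarrow> real \<Rightarrow> real" where
  "left_lim a \<alpha> x = (if x = a then \<alpha> a else Lim (at_left x) \<alpha>)"

definition right_lim :: "real \<Rightarrow> (real \<Rightarrow> real) \<Rightarrow> real \<Rightarrow> real" where
  "right_lim b \<alpha> x = (if x = b then \<alpha> b else Lim (at_right x) \<alpha>)"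

definition mu_open :: "real \<Rightarrow> real \<Rightarrow> (real \<Rightarrow> real) \<Rightarrow> real \<Rightarrow> real \<Rightarrow> real" where
  "mu_open a b \<alpha> c d = left_lim a \<alpha> d - right_lim b \<alpha> c"

definition mu_point :: "real \<Rightarrow> real \<Rightarrow> (real \<Rightarrow> real) \<Rightarrow> real \<Rightarrow> real" where
  "mu_point a b \<alpha> c = right_lim b \<alpha> c - left_lim a \<alpha> c"

text \<open>A partition is given by \<open>n\<close> and the points \<open>x 0, \<dots>, x n\<close>; other values of \<open>x\<close> are
  irrelevant. Open subintervals are indexed from \<open>0\<close>: the interval with index \<open>i < n\<close> is
  \<open>{x i<..<x (Suc i)}\<close>.\<close>

definition is_partition :: "real \<Rightarrow> real \<Rightarrow> nat \<Rightarrow> (nat \<Rightarrow> real) \<Rightarrow> bool" where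
  "is_partition a b n x \<longleftrightarrow> x 0 = a \<and> x n = b \<and> (\<forall>i<n. x i < x (Suc i))"

definition step_wrt ::
  "real \<Rightarrow> real \<Rightarrow> (real \<Rightarrow> real) \<Rightarrow> nat \<Rightarrow> (nat \<Rightarrow> real) \<Rightarrow> (nat \<Rightarrow> real) \<Rightarrow> bool" where
  "step_wrt a b u n x c \<longleftrightarrow>
     is_partition a b n x \<and> (\<forall>i<n. \<forall>t\<in>{x i<..<x (Suc i)}. u t = c i)"

definition step_function :: "real \<Rightarrow> real \<Rightarrow> (real \<Rightarrow> real) \<Rightarrow> bool" where
  "step_function a b u \<longleftrightarrow> bounded (u ` {a..b}) \<and> (\<exists>n x c. step_wrt a b u n x c)"

definition step_sum ::
  "real \<Rightarrow> real \<Rightarrow> (real \<Rightarrow> real) \<Rightarrow> (real \<Rightarrow> real) \<Rightarrow> nat \<Rightarrow> (nat \<Rightarrow> real) \<Rightarrow> (nat \<Rightarrow> real) \<Rightarrow> real" where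
  "step_sum a b \<alpha> u n x c =
     (\<Sum>i\<le>n. u (x i) * mu_point a b \<alpha> (x i)) + (\<Sum>i<n. c i * mu_open a b \<alpha> (x i) (x (Suc i)))"

text \<open>The sum does not depend on the representation of the step function, so the definite
  description below denotes it whenever \<open>u\<close> is a step function on \<open>[a,b]\<close>.\<close>

definition step_integral :: "real \<Rightarrow> real \<Rightarrow> (real \<Rightarrow> real) \<Rightarrow> (real \<Rightarrow> real) \<Rightarrow> real" where
  "step_integral a b \<alpha> u =
     (THE s. \<exists>n x c. step_wrt a b u n x c \<and> s = step_sum a b \<alpha> u n x c)"

text \<open>For \<open>a < b\<close>, nondecreasing \<open>\<alpha>\<close> and bounded \<open>f\<close>, the suprema and infima of sets of reals
  below are taken over nonempty sets bounded on the relevant side.\<close>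

definition rds_lower :: "real \<Rightarrow> real \<Rightarrow> (real \<Rightarrow> real) \<Rightarrow> (real \<Rightarrow> real) \<Rightarrow> real" where
  "rds_lower a b \<alpha> f =
     Sup {step_integral a b \<alpha> v | v. step_function a b v \<and> (\<forall>t\<in>{a..b}. v t \<le> f t)}"

definition rds_upper :: "real \<Rightarrow> real \<Rightarrow> (real \<Rightarrow> real) \<Rightarrow> (real \<Rightarrow> real) \<Rightarrow> real" where
  "rds_upper a b \<alpha> f =
     Inf {step_integral a b \<alpha> u | u. step_function a b u \<and> (\<forall>t\<in>{a..b}. f t \<le> u t)}"

definition rds_integrable :: "real \<Rightarrow> real \<Rightarrow> (real \<Rightarrow> real) \<Rightarrow> (real \<Rightarrow> real) \<Rightarrow> bool" where
  "rds_integrable a b \<alpha> f \<longleftrightarrow> rds_lower a b \<alpha> f = rds_upper a b \<alpha> f"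

text \<open>Meaningful only for integrable \<open>f\<close>, where it is the common value of the lower and the
  upper integral; likewise for Ross's integral.\<close>

definition rds_integral :: "real \<Rightarrow> real \<Rightarrow> (real \<Rightarrow> real) \<Rightarrow> (real \<Rightarrow> real) \<Rightarrow> real" where
  "rds_integral a b \<alpha> f = rds_lower a b \<alpha> f"

definition cell_sup :: "(real \<Rightarrow> real) \<Rightarrow> (nat \<Rightarrow> real) \<Rightarrow> nat \<Rightarrow> real" where
  "cell_sup f x i = (SUP t\<in>{x i<..<x (Suc i)}. f t)"

definition cell_inf :: "(real \<Rightarrow> real) \<Rightarrow> (nat \<Rightarrow> real) \<Rightarrow> nat \<Rightarrow> real" where
  "cell_inf f x i = (INF t\<in>{x i<..<x (Suc i)}. f t)"

text \<open>For \<open>t\<close> in \<open>[a,b]\<close> that is not a partition point, \<open>cell_index n x t\<close> is the index of the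
  unique open subinterval containing \<open>t\<close>.\<close>

definition cell_index :: "nat \<Rightarrow> (nat \<Rightarrow> real) \<Rightarrow> real \<Rightarrow> nat" where
  "cell_index n x t = (THE i. i < n \<and> t \<in> {x i<..<x (Suc i)})"

definition best_fit_upper ::
  "(real \<Rightarrow> real) \<Rightarrow> nat \<Rightarrow> (nat \<Rightarrow> real) \<Rightarrow> real \<Rightarrow> real" where
  "best_fit_upper f n x t = (if t \<in> x ` {..n} then f t else cell_sup f x (cell_index n x t))"

definition best_fit_lower ::
  "(real \<Rightarrow> real) \<Rightarrow> nat \<Rightarrow> (nat \<Rightarrow> real) \<Rightarrow> real \<Rightarrow> real" where
  "best_fit_lower f n x t = (if t \<in> x ` {..n} then f t else cell_inf f x (cell_index n x t))"

definition ross_jump ::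
  "real \<Rightarrow> real \<Rightarrow> (real \<Rightarrow> real) \<Rightarrow> (real \<Rightarrow> real) \<Rightarrow> nat \<Rightarrow> (nat \<Rightarrow> real) \<Rightarrow> real" where
  "ross_jump a b \<alpha> f n x =
     (\<Sum>i\<le>n. f (x i) * (right_lim b \<alpha> (x i) - left_lim a \<alpha> (x i)))"

definition ross_upper_sum ::
  "real \<Rightarrow> real \<Rightarrow> (real \<Rightarrow> real) \<Rightarrow> (real \<Rightarrow> real) \<Rightarrow> nat \<Rightarrow> (nat \<Rightarrow> real) \<Rightarrow> real" where
  "ross_upper_sum a b \<alpha> f n x = ross_jump a b \<alpha> f n x +
     (\<Sum>i<n. cell_sup f x i * (left_lim a \<alpha> (x (Suc i)) - right_lim b \<alpha> (x i)))"

definition ross_lower_sum ::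
  "real \<Rightarrow> real \<Rightarrow> (real \<Rightarrow> real) \<Rightarrow> (real \<Rightarrow> real) \<Rightarrow> nat \<Rightarrow> (nat \<Rightarrow> real) \<Rightarrow> real" where
  "ross_lower_sum a b \<alpha> f n x = ross_jump a b \<alpha> f n x +
     (\<Sum>i<n. cell_inf f x i * (left_lim a \<alpha> (x (Suc i)) - right_lim b \<alpha> (x i)))"

definition ross_upper :: "real \<Rightarrow> real \<Rightarrow> (real \<Rightarrow> real) \<Rightarrow> (real \<Rightarrow> real) \<Rightarrow> real" where
  "ross_upper a b \<alpha> f = Inf {ross_upper_sum a b \<alpha> f n x | n x. is_partition a b n x}"

definition ross_lower :: "real \<Rightarrow> real \<Rightarrow> (real \<Rightarrow> real) \<Rightarrow> (real \<Rightarrow> real) \<Rightarrow> real" where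
  "ross_lower a b \<alpha> f = Sup {ross_lower_sum a b \<alpha> f n x | n x. is_partition a b n x}"

definition ross_integrable :: "real \<Rightarrow> real \<Rightarrow> (real \<Rightarrow> real) \<Rightarrow> (real \<Rightarrow> real) \<Rightarrow> bool" where
  "ross_integrable a b \<alpha> f \<longleftrightarrow> ross_upper a b \<alpha> f = ross_lower a b \<alpha> f"

definition ross_integral :: "real \<Rightarrow> real \<Rightarrow> (real \<Rightarrow> real) \<Rightarrow> (real \<Rightarrow> real) \<Rightarrow> real" where
  "ross_integral a b \<alpha> f = ross_upper a b \<alpha> f"

end

(* The one-sided limits of \<alpha> define a finite Borel measure on the line giving points and open
   intervals the masses \<mu>_\<alpha>. Integration of a step function against it shows that its integral
   is well defined and monotone. Among the step functions above (below) f that are constant on the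
   cells of a given partition, the best-fit one has the smallest (largest) integral, namely Ross's
   upper (lower) sum; hence the RDS upper and lower integrals coincide with Ross's. Since Ross's
   sums improve under refinement, the epsilon criterion follows by taking a common refinement. *)

theory Submission
  imports Defs "HOL-Probability.Distribution_Functions"
begin

section \<open>One-sided limits and the measure of a monotone integrator\<close>

text \<open>Clamping the argument to [a,b] gives a function monotone on the whole line, so its left
  limits exist as suprema. Left of a it is constantly \<open>\<alpha> a\<close>, which builds in the
  convention \<alpha>(a-) = \<alpha>(a).\<close>

lemma left_lim_mono_on:
  assumes ab: "a < b" and \<alpha>: "mono_on {a..b} \<alpha>" and x: "x \<in> {a..b}"
  shows "((\<lambda>t. \<alpha> (max a (min b t))) \<longlongrightarrow> left_lim a \<alpha> x) (at_left x)"
proof (cases "x = a")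
  case True
  have "\<forall>\<^sub>F t in at_left a. \<alpha> (max a (min b t)) = \<alpha> a"
    using ab by (auto simp: eventually_at_filter max_def min_def)
  then show ?thesis
    using True by (simp add: left_lim_def tendsto_eventually)
next
  case False
  let ?g = "\<lambda>t. \<alpha> (max a (min b t))"
  have mono: "?g s \<le> ?g t" if "s \<le> t" for s t
    using \<alpha> ab that by (intro mono_onD[OF \<alpha>]) auto
  have lim: "(?g \<longlongrightarrow> Sup (?g ` ({..<x} \<inter> UNIV))) (at x within {..<x} \<inter> UNIV)"
    by (rule Lim_left_bound[where K="?g x"]) (auto intro: mono)
  \<comment> \<open>Clamping changes nothing on (a,x). The limit therefore passes to \<alpha>
    itself, and the \<open>Lim\<close> in the definition denotes it.\<close>
  have "\<forall>\<^sub>F t in at_left x. ?g t = \<alpha> t"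
    using eventually_at_left_real[of a x] x False
    by (auto elim!: eventually_mono simp: max_def min_def)
  then have "(\<alpha> \<longlongrightarrow> Sup (?g ` {..<x})) (at_left x)"
    using lim by (auto simp: tendsto_cong)
  then have "left_lim a \<alpha> x = Sup (?g ` {..<x})"
    using False by (simp add: left_lim_def tendsto_Lim)
  then show ?thesis using lim by simp
qed

lemma right_lim_mono_on:
  assumes ab: "a < b" and \<alpha>: "mono_on {a..b} \<alpha>" and x: "x \<in> {a..b}"
  shows "((\<lambda>t. \<alpha> (max a (min b t))) \<longlongrightarrow> right_lim b \<alpha> x) (at_right x)"
proof (cases "x = b")
  case True
  have "\<forall>\<^sub>F t in at_right b. \<alpha> (max a (min b t)) = \<alpha> b"
    using ab by (auto simp: eventually_at_filter max_def min_def)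
  then show ?thesis
    using True by (simp add: right_lim_def tendsto_eventually)
next
  case False
  let ?g = "\<lambda>t. \<alpha> (max a (min b t))"
  have mono: "?g s \<le> ?g t" if "s \<le> t" for s t
    using \<alpha> ab that by (intro mono_onD[OF \<alpha>]) auto
  have lim: "(?g \<longlongrightarrow> Inf (?g ` ({x<..} \<inter> UNIV))) (at x within {x<..} \<inter> UNIV)"
    by (rule Lim_right_bound[where K="?g x"]) (auto intro: mono)
  have "\<forall>\<^sub>F t in at_right x. ?g t = \<alpha> t"
    using eventually_at_right_real[of x b] x False
    by (auto elim!: eventually_mono simp: max_def min_def)
  then have "(\<alpha> \<longlongrightarrow> Inf (?g ` {x<..})) (at_right x)"
    using lim by (auto simp: tendsto_cong)
  then have "right_lim b \<alpha> x = Inf (?g ` {x<..})"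
    using False by (simp add: right_lim_def tendsto_Lim)
  then show ?thesis using lim by simp
qed

text \<open>The right-continuous regularisation of \<open>\<alpha>\<close>, extended by constants outside \<open>[a,b]\<close>,
  is the distribution function.\<close>

lemma stieltjes_measure_exists:
  assumes ab: "a < b" and \<alpha>: "mono_on {a..b} \<alpha>"
  obtains M where "finite_borel_measure M"
    and "\<forall>c\<in>{a..b}. measure M {c} = mu_point a b \<alpha> c"
    and "\<forall>c d. a \<le> c \<and> c < d \<and> d \<le> b \<longrightarrow> measure M {c<..<d} = mu_open a b \<alpha> c d"
proof -
  define g where "g t = \<alpha> (max a (min b t))" for t
  \<comment> \<open>The infimum over points to the right makes \<open>F\<close> right-continuous;
    subtracting \<open>\<alpha> a\<close> makes it vanish at minus infinity, as a distribution
    function must.\<close>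
  define F where "F t = Inf (g ` {t<..}) - \<alpha> a" for t
  have mono: "g s \<le> g t" if "s \<le> t" for s t
    using \<alpha> ab that unfolding g_def by (intro mono_onD[OF \<alpha>]) auto
  have bdd: "bdd_below (g ` {t<..})" for t
    by (rule bdd_belowI[of _ "g t"]) (auto intro: mono)
  \<comment> \<open>Together with the next fact, \<open>F + \<alpha> a\<close> is squeezed between
    \<open>g t\<close> and every \<open>g s\<close> with s > t. The strict inequality there is why
    intermediate points r are inserted below.\<close>
  have g_le_F: "g t \<le> F t + \<alpha> a" for t
    unfolding F_def by (auto intro!: cINF_greatest mono)
  have F_le_g: "F t + \<alpha> a \<le> g s" if "t < s" for s t
    unfolding F_def using that by (auto intro!: cINF_lower bdd)
  have F_mono: "F s \<le> F t" if "s \<le> t" for s t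
    unfolding F_def using that bdd by (auto intro!: cINF_superset_mono mono)
  have F_lim: "(g \<longlongrightarrow> F x + \<alpha> a) (at_right x)" for x
    using Lim_right_bound[of UNIV x g "g x"] by (auto simp: F_def mono)
  have F_cont: "continuous (at_right x) F" for x
    unfolding continuous_within
  proof (rule order_tendstoI)
    fix y assume "y < F x"
    then show "\<forall>\<^sub>F t in at_right x. y < F t"
      by (intro eventually_mono[OF eventually_at_right_less]) (rule less_le_trans[OF _ F_mono], auto)
  next
    fix y assume "F x < y"
    then have "\<forall>\<^sub>F t in at_right x. g t < y + \<alpha> a"
      using order_tendstoD(2)[OF F_lim] by simp
    then obtain s where s: "x < s" "\<And>t. x < t \<Longrightarrow> t < s \<Longrightarrow> g t < y + \<alpha> a"
      unfolding eventually_at_right_field by auto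
    have "F t < y" if "x < t" "t < s" for t
    proof -
      obtain r where "t < r" "r < s" using dense[OF \<open>t < s\<close>] by auto
      then show ?thesis using F_le_g[of t r] s(2)[of r] that by simp
    qed
    then show "\<forall>\<^sub>F t in at_right x. F t < y"
      unfolding eventually_at_right_field using s(1) by auto
  qed
  \<comment> \<open>Only t < a is claimed: \<open>F a + \<alpha> a\<close> is the right limit at a,
    so a jump of \<alpha> at a becomes mass of the point a.\<close>
  have F_below: "F t = 0" if "t < a" for t
    using g_le_F[of t] F_le_g[of t a] that ab by (simp add: g_def)
  have F_above: "F t = \<alpha> b - \<alpha> a" if "b \<le> t" for t
    using g_le_F[of t] F_le_g[of t "t + 1"] that ab by (simp add: g_def)
  have at_bot: "(F \<longlongrightarrow> 0) at_bot"
    by (rule tendsto_eventually) (use F_below in \<open>auto simp: eventually_at_bot_dense\<close>)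
  have at_top: "(F \<longlongrightarrow> \<alpha> b - \<alpha> a) at_top"
    by (rule tendsto_eventually) (use F_above in \<open>auto simp: eventually_at_top_linorder\<close>)
  define M where "M = interval_measure F"
  have le: "0 \<le> \<alpha> b - \<alpha> a"
    using mono_onD[OF \<alpha>, of a b] ab by simp
  have fin: "finite_borel_measure M"
    unfolding M_def by (rule finite_borel_measure_interval_measure[OF F_mono F_cont at_bot at_top le])
  interpret finite_borel_measure M by (fact fin)
  have cdf: "cdf M t = F t" for t
    unfolding M_def cdf_def by (rule measure_interval_measure_Iic[OF F_mono F_cont at_bot])
  have R: "right_lim b \<alpha> x = F x + \<alpha> a" if "x \<in> {a..b}" for x
    using tendsto_unique[OF _ F_lim] right_lim_mono_on[OF ab \<alpha> that]
    by (simp add: g_def[abs_def])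
  \<comment> \<open>The mass of \<open>{..<x}\<close> is the left limit of the distribution function
    \<open>F\<close>. By the squeeze, \<open>g\<close> and \<open>F + \<alpha> a\<close> have the
    same left limit.\<close>
  have L: "left_lim a \<alpha> x = measure M {..<x} + \<alpha> a" if "x \<in> {a..b}" for x
  proof (rule tendsto_unique)
    show "(g \<longlongrightarrow> left_lim a \<alpha> x) (at_left x)"
      using left_lim_mono_on[OF ab \<alpha> that] by (simp add: g_def[abs_def])
    show "(g \<longlongrightarrow> measure M {..<x} + \<alpha> a) (at_left x)"
    proof (rule order_tendstoI)
      fix y assume "measure M {..<x} + \<alpha> a < y"
      moreover have "g t \<le> measure M {..<x} + \<alpha> a" if "t < x" for t
      proof -
        have "F t \<le> measure M {..<x}"
          unfolding cdf[symmetric] cdf_def using that by (intro finite_measure_mono) auto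
        then show ?thesis using g_le_F[of t] by simp
      qed
      ultimately show "\<forall>\<^sub>F t in at_left x. g t < y"
        by (intro eventually_mono[OF eventually_at_left_real[of "x - 1"]]) (auto intro: le_less_trans)
    next
      fix y assume "y < measure M {..<x} + \<alpha> a"
      then have "\<forall>\<^sub>F t in at_left x. y - \<alpha> a < F t"
        using order_tendstoD(1)[OF cdf_at_left] by (simp add: cdf[abs_def] cdf)
      then obtain s where s: "s < x" "\<And>t. s < t \<Longrightarrow> t < x \<Longrightarrow> y - \<alpha> a < F t"
        unfolding eventually_at_left_field by auto
      have "y < g t" if "s < t" "t < x" for t
      proof -
        obtain r where "s < r" "r < t" using dense[OF \<open>s < t\<close>] by auto
        then show ?thesis using F_le_g[of r t] s(2)[of r] that by simp
      qed
      then show "\<forall>\<^sub>F t in at_left x. y < g t"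
        unfolding eventually_at_left_field using s(1) by auto
    qed
  qed simp
  show thesis
  proof
    show "finite_borel_measure M" by (fact fin)
  next
    show "\<forall>c\<in>{a..b}. measure M {c} = mu_point a b \<alpha> c"
    proof
      fix c assume c: "c \<in> {a..b}"
      have "measure M {..c} = measure M {..<c} + measure M {c}"
        by (subst finite_measure_Union[symmetric]) (auto intro!: arg_cong[where f="measure M"])
      then show "measure M {c} = mu_point a b \<alpha> c"
        using cdf[of c] by (simp add: cdf_def mu_point_def L[OF c] R[OF c])
    qed
  next
    show "\<forall>c d. a \<le> c \<and> c < d \<and> d \<le> b \<longrightarrow> measure M {c<..<d} = mu_open a b \<alpha> c d"
    proof (intro allI impI)
      fix c d assume cd: "a \<le> c \<and> c < d \<and> d \<le> b"
      have "measure M {..<d} = measure M {..c} + measure M {c<..<d}"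
        using cd by (subst finite_measure_Union[symmetric]) (auto intro!: arg_cong[where f="measure M"])
      then show "measure M {c<..<d} = mu_open a b \<alpha> c d"
        using cdf[of c] cd by (simp add: cdf_def mu_open_def L R)
    qed
  qed
qed

section \<open>Partitions and step functions\<close>

lemma partition_mono:
  assumes "is_partition a b n x" and "i \<le> j" and "j \<le> n"
  shows "x i \<le> x j"
  using assms(2,3)
proof (induction j rule: dec_induct)
  case (step j)
  then have "x i \<le> x j" "x j < x (Suc j)" using assms(1) by (auto simp: is_partition_def)
  then show ?case by simp
qed simp

lemma partition_in_interval:
  assumes "is_partition a b n x" and "i \<le> n"
  shows "x i \<in> {a..b}"
  using partition_mono[OF assms(1), of 0 i] partition_mono[OF assms(1), of i n] assms
  by (simp add: is_partition_def)

text \<open>Expresses u through indicators of points and cells, ready for termwise integration. The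
  conjunct \<open>x 0 \<le> x k\<close> is carried through the induction because it lets the next
  interval split into the old one, a new cell and a new point.\<close>

lemma step_decomposition:
  fixes x :: "nat \<Rightarrow> real" and u :: "real \<Rightarrow> real"
  assumes "\<And>i. i < k \<Longrightarrow> x i < x (Suc i)"
    and "\<And>i t. i < k \<Longrightarrow> t \<in> {x i<..<x (Suc i)} \<Longrightarrow> u t = c i"
  shows "x 0 \<le> x k \<and> indicator {x 0..x k} t * u t =
    (\<Sum>i\<le>k. u (x i) * indicator {x i} t) + (\<Sum>i<k. c i * indicator {x i<..<x (Suc i)} t)"
  using assms
proof (induction k)
  case (Suc k)
  have *: "x 0 \<le> x k" "x k < x (Suc k)" using Suc by auto
  have "indicator {x 0..x (Suc k)} t * u t = indicator {x 0..x k} t * u t +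
      (u (x (Suc k)) * indicator {x (Suc k)} t + c k * indicator {x k<..<x (Suc k)} t)"
    using * Suc.prems(2)[of k t] by (auto simp: indicator_def)
  moreover have "x 0 \<le> x (Suc k)" using * by simp
  moreover have "indicator {x 0..x k} t * u t =
      (\<Sum>i\<le>k. u (x i) * indicator {x i} t) + (\<Sum>i<k. c i * indicator {x i<..<x (Suc i)} t)"
    using Suc by auto
  ultimately show ?case by (simp only: sum.atMost_Suc sum.lessThan_Suc) (simp add: algebra_simps)
qed (auto simp: indicator_def)

lemma partition_cases:
  assumes x: "is_partition a b n x" and t: "t \<in> {a..b}"
  shows "t \<in> x ` {..n} \<or> (\<exists>i<n. t \<in> {x i<..<x (Suc i)})"
proof -
  have "t \<in> x ` {..k} \<or> (\<exists>i<k. t \<in> {x i<..<x (Suc i)})" if "x 0 \<le> t" "t \<le> x k" for k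
    using that
  proof (induction k)
    case (Suc k)
    consider "t \<le> x k" | "t = x (Suc k)" | "t \<in> {x k<..<x (Suc k)}" using Suc.prems by force
    then show ?case
    proof cases
      case 1
      then show ?thesis using Suc.IH Suc.prems by (auto simp: atMost_Suc intro: less_SucI)
    qed auto
  qed auto
  then show ?thesis using x t by (simp add: is_partition_def)
qed

lemma step_wrt_values:
  assumes "step_wrt a b u n x c"
  shows "u ` {a..b} \<subseteq> u ` x ` {..n} \<union> c ` {..<n}"
  using partition_cases[of a b n x] assms by (fastforce simp: step_wrt_def)

lemma step_wrt_step_function:
  assumes "step_wrt a b u n x c"
  shows "step_function a b u"
proof -
  have "finite (u ` {a..b})"
    by (rule finite_subset[OF step_wrt_values[OF assms]]) auto
  then show ?thesis using assms by (auto simp: step_function_def finite_imp_bounded)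
qed


text \<open>Integrate the indicator decomposition term by term. The integrand does not mention n, x
  or c, which is the source of both independence of the representation and monotonicity.\<close>

lemma step_sum_eq_integral:
  assumes M: "finite_borel_measure M"
    and point: "\<forall>c\<in>{a..b}. measure M {c} = mu_point a b \<alpha> c"
    and ivl: "\<forall>c d. a \<le> c \<and> c < d \<and> d \<le> b \<longrightarrow> measure M {c<..<d} = mu_open a b \<alpha> c d"
    and u: "step_wrt a b u n x c"
  shows "has_bochner_integral M (\<lambda>t. indicator {a..b} t * u t) (step_sum a b \<alpha> u n x c)"
proof -
  interpret finite_borel_measure M by (fact M)
  have P: "is_partition a b n x" using u by (simp add: step_wrt_def)
  have eq: "(\<lambda>t. indicator {a..b} t * u t) =
      (\<lambda>t. (\<Sum>i\<le>n. u (x i) * indicator {x i} t) + (\<Sum>i<n. c i * indicator {x i<..<x (Suc i)} t))"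
    using step_decomposition[of n x u c] u by (auto simp: step_wrt_def is_partition_def)
  have ind: "has_bochner_integral M (indicator A) (measure M A)" if "A \<in> sets borel" for A
    using that by (intro has_bochner_integral_real_indicator sets_M) (auto simp: emeasure_eq_measure)
  have "measure M {x i} = mu_point a b \<alpha> (x i)" if "i \<le> n" for i
    using partition_in_interval[OF P that] point by blast
  moreover have "measure M {x i<..<x (Suc i)} = mu_open a b \<alpha> (x i) (x (Suc i))" if "i < n" for i
    using partition_in_interval[OF P, of i] partition_in_interval[OF P, of "Suc i"] that P
    by (intro ivl[rule_format]) (auto simp: is_partition_def)
  ultimately have sum_eq: "step_sum a b \<alpha> u n x c = (\<Sum>i\<le>n. u (x i) * measure M {x i}) +
      (\<Sum>i<n. c i * measure M {x i<..<x (Suc i)})"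
    by (simp add: step_sum_def)
  show ?thesis
    unfolding eq sum_eq
    by (intro has_bochner_integral_add has_bochner_integral_sum has_bochner_integral_mult_right ind) auto
qed

text \<open>An open cell of y contains no point of x, so it lies inside a single cell of x, where u
  is constant.\<close>

lemma step_wrt_refine:
  assumes u: "step_wrt a b u n x c" and y: "is_partition a b m y"
    and sub: "x ` {..n} \<subseteq> y ` {..m}"
  obtains d where "step_wrt a b u m y d"
proof -
  have x: "is_partition a b n x" using u by (simp add: step_wrt_def)
  have "\<exists>d. \<forall>t\<in>{y j<..<y (Suc j)}. u t = d" if j: "j < m" for j
  proof -
    have no_point: "t \<notin> x ` {..n}" if t: "t \<in> {y j<..<y (Suc j)}" for t
    proof
      assume "t \<in> x ` {..n}"
      then obtain k where k: "k \<le> m" "t = y k" using sub by auto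
      then show False
        using t j partition_mono[OF y, of k j] partition_mono[OF y, of "Suc j" k] by force
    qed
    have mem: "t \<in> {a..b}" if t: "t \<in> {y j<..<y (Suc j)}" for t
      using t j partition_in_interval[OF y, of j] partition_in_interval[OF y, of "Suc j"] by auto
    \<comment> \<open>A sample point selects the cell of x. An end of that cell failing either
      inequality below would be a point of x strictly inside the cell of y.\<close>
    obtain s where s: "s \<in> {y j<..<y (Suc j)}"
      using y j dense[of "y j" "y (Suc j)"] by (auto simp: is_partition_def)
    obtain i where i: "i < n" "s \<in> {x i<..<x (Suc i)}"
      using partition_cases[OF x mem[OF s]] no_point[OF s] by blast
    have "x i \<le> y j"
    proof (rule ccontr)
      assume "\<not> x i \<le> y j"
      then show False using no_point[of "x i"] i s by auto
    qed
    moreover have "y (Suc j) \<le> x (Suc i)"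
    proof (rule ccontr)
      assume "\<not> y (Suc j) \<le> x (Suc i)"
      then show False using no_point[of "x (Suc i)"] i s by auto
    qed
    ultimately show ?thesis
      using u i by (intro exI[of _ "c i"]) (auto simp: step_wrt_def)
  qed
  then obtain d where "\<forall>j<m. \<forall>t\<in>{y j<..<y (Suc j)}. u t = d j" by metis
  then show thesis using that y by (auto simp: step_wrt_def)
qed

text \<open>List S in increasing order: its extreme entries are a and b because S contains both and
  lies in [a,b]. The number of cells is one less than the number of points.\<close>

lemma partition_of_finite_set:
  assumes "finite S" and "a \<in> S" and "b \<in> S" and "S \<subseteq> {a..b}"
  obtains m y where "is_partition a b m y" and "y ` {..m} = S"
proof
  define xs where "xs = sorted_list_of_set S"
  have xs: "set xs = S" "sorted xs" "distinct xs" "xs \<noteq> []" using assms by (auto simp: xs_def)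
  have ran: "(!) xs ` {..length xs - 1} = S"
    using xs(1,4) by (auto simp: set_conv_nth image_def) (metis Suc_pred atMost_iff length_greater_0_conv less_Suc_eq_le)
  show "(!) xs ` {..length xs - 1} = S" by (fact ran)
  have nth: "xs ! i \<in> {a..b}" if "i < length xs" for i
    using that xs(1) assms(4) nth_mem by blast
  obtain i j where "i < length xs" "xs ! i = a" "j < length xs" "xs ! j = b"
    using xs(1) assms(2,3) by (metis in_set_conv_nth)
  then have "xs ! 0 \<le> a" "b \<le> xs ! (length xs - 1)"
    using sorted_nth_mono[OF xs(2), of 0 i] sorted_nth_mono[OF xs(2), of j "length xs - 1"] by auto
  then have "xs ! 0 = a" "xs ! (length xs - 1) = b"
    using nth[of 0] nth[of "length xs - 1"] xs(4) by (auto simp: not_le)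
  \<comment> \<open>Sortedness gives only the weak inequality; distinctness makes it strict.\<close>
  moreover have "xs ! i < xs ! Suc i" if "i < length xs - 1" for i
    using that less_diff_conv[of i "length xs" 1] sorted_nth_mono[OF xs(2), of i "Suc i"] nth_eq_iff_index_eq[OF xs(3), of i "Suc i"] by auto
  ultimately show "is_partition a b (length xs - 1) ((!) xs)"
    by (simp add: is_partition_def)
qed

lemma common_refinement:
  assumes x: "is_partition a b n x" and y: "is_partition a b m y"
  obtains k z where "is_partition a b k z" and "x ` {..n} \<subseteq> z ` {..k}" and "y ` {..m} \<subseteq> z ` {..k}"
proof -
  have "a \<in> x ` {..n}" "b \<in> x ` {..n}" using x by (auto simp: is_partition_def)
  moreover have "x ` {..n} \<union> y ` {..m} \<subseteq> {a..b}"
    using partition_in_interval[OF x] partition_in_interval[OF y] by auto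
  ultimately obtain k z where "is_partition a b k z" "z ` {..k} = x ` {..n} \<union> y ` {..m}"
    using partition_of_finite_set[of "x ` {..n} \<union> y ` {..m}" a b] by auto
  then show thesis using that by auto
qed

section \<open>Best-fit step functions\<close>

text \<open>Monotonicity of the points separates the cells from each other and from the points. This
  makes the description in \<open>cell_index\<close> unique and selects the cell branch of the
  best-fit functions.\<close>

lemma cell_index_eq:
  assumes x: "is_partition a b n x" and i: "i < n" "t \<in> {x i<..<x (Suc i)}"
  shows "cell_index n x t = i" and "t \<notin> x ` {..n}"
proof -
  show "cell_index n x t = i"
    unfolding cell_index_def
  proof (rule the_equality)
    fix j assume j: "j < n \<and> t \<in> {x j<..<x (Suc j)}"
    then show "j = i"
      using partition_mono[OF x, of "Suc j" i] partition_mono[OF x, of "Suc i" j] i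
      by (cases j i rule: linorder_cases) auto
  qed (use i in auto)
  show "t \<notin> x ` {..n}"
  proof
    assume "t \<in> x ` {..n}"
    then obtain k where "k \<le> n" "t = x k" by auto
    then show False
      using i partition_mono[OF x, of k i] partition_mono[OF x, of "Suc i" k] by force
  qed
qed

lemma best_fit_step:
  assumes "is_partition a b n x"
  shows "step_wrt a b (best_fit_upper f n x) n x (cell_sup f x)"
    and "step_wrt a b (best_fit_lower f n x) n x (cell_inf f x)"
    and "step_wrt a b (\<lambda>t. best_fit_upper f n x t - best_fit_lower f n x t) n x
           (\<lambda>i. cell_sup f x i - cell_inf f x i)"
  using assms cell_index_eq[OF assms]
  by (simp_all add: step_wrt_def best_fit_upper_def best_fit_lower_def)

text \<open>At partition points both best-fit functions take the value of f, so the point terms form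
  \<open>ross_jump\<close> and cancel in the difference.\<close>

lemma best_fit_sum:
  "step_sum a b \<alpha> (best_fit_upper f n x) n x (cell_sup f x) = ross_upper_sum a b \<alpha> f n x"
  "step_sum a b \<alpha> (best_fit_lower f n x) n x (cell_inf f x) = ross_lower_sum a b \<alpha> f n x"
  "step_sum a b \<alpha> (\<lambda>t. best_fit_upper f n x t - best_fit_lower f n x t) n x
     (\<lambda>i. cell_sup f x i - cell_inf f x i) = ross_upper_sum a b \<alpha> f n x - ross_lower_sum a b \<alpha> f n x"
  by (simp_all add: step_sum_def best_fit_upper_def best_fit_lower_def ross_upper_sum_def
      ross_lower_sum_def ross_jump_def mu_point_def mu_open_def left_diff_distrib sum_subtractf)

lemma best_fit_bounds:
  assumes x: "is_partition a b n x" and f: "bounded (f ` {a..b})" and t: "t \<in> {a..b}"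
  shows "best_fit_lower f n x t \<le> f t" and "f t \<le> best_fit_upper f n x t"
proof -
  have "best_fit_lower f n x t \<le> f t \<and> f t \<le> best_fit_upper f n x t"
  proof (cases "t \<in> x ` {..n}")
    case True
    then show ?thesis by (simp add: best_fit_lower_def best_fit_upper_def)
  next
    case False
    then obtain i where i: "i < n" "t \<in> {x i<..<x (Suc i)}"
      using partition_cases[OF x t] by auto
    have "{x i<..<x (Suc i)} \<subseteq> {a..b}"
      using partition_in_interval[OF x, of i] partition_in_interval[OF x, of "Suc i"] i by auto
    \<comment> \<open>Boundedness ensures that \<open>cell_sup\<close> and \<open>cell_inf\<close>
      really bound f on the cell, the real \<open>Sup\<close> and \<open>Inf\<close> being only
      conditionally meaningful.\<close>
    then have "bounded (f ` {x i<..<x (Suc i)})"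
      using f by (meson bounded_subset image_mono)
    then have "bdd_below (f ` {x i<..<x (Suc i)})" "bdd_above (f ` {x i<..<x (Suc i)})"
      by (auto simp: bounded_imp_bdd_below bounded_imp_bdd_above)
    then have "cell_inf f x i \<le> f t" "f t \<le> cell_sup f x i"
      unfolding cell_inf_def cell_sup_def using i by (auto intro: cINF_lower cSUP_upper)
    then show ?thesis
      using False cell_index_eq[OF x i] by (simp add: best_fit_lower_def best_fit_upper_def)
  qed
  then show "best_fit_lower f n x t \<le> f t" "f t \<le> best_fit_upper f n x t" by auto
qed

section \<open>Monotonicity of step integrals and comparison with Ross's sums\<close>

context
  fixes a b :: real and \<alpha> :: "real \<Rightarrow> real"
  assumes ab: "a < b" and \<alpha>: "mono_on {a..b} \<alpha>"
begin

lemma mu_nonneg: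
  shows "c \<in> {a..b} \<Longrightarrow> 0 \<le> mu_point a b \<alpha> c"
    and "a \<le> c \<Longrightarrow> c < d \<Longrightarrow> d \<le> b \<Longrightarrow> 0 \<le> mu_open a b \<alpha> c d"
proof -
  obtain M where M: "finite_borel_measure M"
      "\<forall>c\<in>{a..b}. measure M {c} = mu_point a b \<alpha> c"
      "\<forall>c d. a \<le> c \<and> c < d \<and> d \<le> b \<longrightarrow> measure M {c<..<d} = mu_open a b \<alpha> c d"
    by (rule stieltjes_measure_exists[OF ab \<alpha>])
  show "c \<in> {a..b} \<Longrightarrow> 0 \<le> mu_point a b \<alpha> c" using M(2) by (metis measure_nonneg)
  show "a \<le> c \<Longrightarrow> c < d \<Longrightarrow> d \<le> b \<Longrightarrow> 0 \<le> mu_open a b \<alpha> c d"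
    using M(3) by (metis measure_nonneg)
qed

text \<open>Both sums are integrals against the same measure, so the two partitions can be
  unrelated.\<close>

lemma step_sum_mono:
  assumes u: "step_wrt a b u n x c" and v: "step_wrt a b v m y d"
    and le: "\<And>t. t \<in> {a..b} \<Longrightarrow> u t \<le> v t"
  shows "step_sum a b \<alpha> u n x c \<le> step_sum a b \<alpha> v m y d"
proof -
  obtain M where M: "finite_borel_measure M"
      "\<forall>c\<in>{a..b}. measure M {c} = mu_point a b \<alpha> c"
      "\<forall>c d. a \<le> c \<and> c < d \<and> d \<le> b \<longrightarrow> measure M {c<..<d} = mu_open a b \<alpha> c d"
    by (rule stieltjes_measure_exists[OF ab \<alpha>])
  have int: "has_bochner_integral M (\<lambda>t. indicator {a..b} t * u t) (step_sum a b \<alpha> u n x c)"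
      "has_bochner_integral M (\<lambda>t. indicator {a..b} t * v t) (step_sum a b \<alpha> v m y d)"
    by (rule step_sum_eq_integral[OF M u], rule step_sum_eq_integral[OF M v])
  have "(\<integral>t. indicator {a..b} t * u t \<partial>M) \<le> (\<integral>t. indicator {a..b} t * v t \<partial>M)"
    using int by (intro integral_mono) (auto simp: has_bochner_integral_iff indicator_def le)
  then show ?thesis using int by (simp add: has_bochner_integral_integral_eq)
qed

lemma step_integral_eq:
  assumes "step_wrt a b u n x c"
  shows "step_integral a b \<alpha> u = step_sum a b \<alpha> u n x c"
  unfolding step_integral_def
  \<comment> \<open>Uniqueness: two representations of the same u are compared in both directions by
    \<open>step_sum_mono\<close>.\<close>
  by (rule the_equality) (use assms in \<open>auto intro!: antisym step_sum_mono\<close>)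

text \<open>Termwise comparison on the partition representing u: the masses are nonnegative, and on
  a cell the constant value of u bounds f, hence its supremum.\<close>

lemma ross_upper_sum_le:
  assumes u: "step_wrt a b u n x c" and le: "\<And>t. t \<in> {a..b} \<Longrightarrow> f t \<le> u t"
  shows "ross_upper_sum a b \<alpha> f n x \<le> step_sum a b \<alpha> u n x c"
  unfolding best_fit_sum(1)[symmetric] step_sum_def
proof (intro add_mono sum_mono mult_right_mono)
  have x: "is_partition a b n x" using u by (simp add: step_wrt_def)
  fix i
  show "best_fit_upper f n x (x i) \<le> u (x i)" "0 \<le> mu_point a b \<alpha> (x i)" if "i \<in> {..n}"
    using partition_in_interval[OF x, of i] that le mu_nonneg(1) by (auto simp: best_fit_upper_def)
  assume "i \<in> {..<n}"
  then have i: "x i < x (Suc i)" "a \<le> x i" "x (Suc i) \<le> b" "i < n"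
    using partition_in_interval[OF x, of i] partition_in_interval[OF x, of "Suc i"] x
    by (auto simp: is_partition_def)
  show "0 \<le> mu_open a b \<alpha> (x i) (x (Suc i))" using i by (intro mu_nonneg(2))
  show "cell_sup f x i \<le> c i"
    unfolding cell_sup_def
  proof (rule cSUP_least)
    fix t assume t: "t \<in> {x i<..<x (Suc i)}"
    then have "f t \<le> u t" using i by (intro le) auto
    then show "f t \<le> c i" using u i t by (simp add: step_wrt_def)
  qed (use i in auto)
qed

lemma ross_lower_sum_ge:
  assumes u: "step_wrt a b u n x c" and le: "\<And>t. t \<in> {a..b} \<Longrightarrow> u t \<le> f t"
  shows "step_sum a b \<alpha> u n x c \<le> ross_lower_sum a b \<alpha> f n x"
  unfolding best_fit_sum(2)[symmetric] step_sum_def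
proof (intro add_mono sum_mono mult_right_mono)
  have x: "is_partition a b n x" using u by (simp add: step_wrt_def)
  fix i
  show "u (x i) \<le> best_fit_lower f n x (x i)" "0 \<le> mu_point a b \<alpha> (x i)" if "i \<in> {..n}"
    using partition_in_interval[OF x, of i] that le mu_nonneg(1) by (auto simp: best_fit_lower_def)
  assume "i \<in> {..<n}"
  then have i: "x i < x (Suc i)" "a \<le> x i" "x (Suc i) \<le> b" "i < n"
    using partition_in_interval[OF x, of i] partition_in_interval[OF x, of "Suc i"] x
    by (auto simp: is_partition_def)
  show "0 \<le> mu_open a b \<alpha> (x i) (x (Suc i))" using i by (intro mu_nonneg(2))
  show "c i \<le> cell_inf f x i"
    unfolding cell_inf_def
  proof (rule cINF_greatest)
    fix t assume t: "t \<in> {x i<..<x (Suc i)}"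
    then have "u t \<le> f t" using i by (intro le) auto
    then show "c i \<le> f t" using u i t by (simp add: step_wrt_def)
  qed (use i in auto)
qed

section \<open>Refinement of Ross's sums and agreement with the RDS integrals\<close>

context
  fixes f :: "real \<Rightarrow> real"
  assumes f: "bounded (f ` {a..b})"
begin

text \<open>The upper best fit for x is also a step function above f with respect to y. Ross's sum
  for y is at most its step sum there, and that sum does not depend on the representation.\<close>

lemma ross_upper_sum_refine:
  assumes "is_partition a b n x" and "is_partition a b m y" and "x ` {..n} \<subseteq> y ` {..m}"
  shows "ross_upper_sum a b \<alpha> f m y \<le> ross_upper_sum a b \<alpha> f n x"
proof -
  obtain d where d: "step_wrt a b (best_fit_upper f n x) m y d"
    using step_wrt_refine[OF best_fit_step(1) assms(2,3)] assms(1) by blast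
  have "ross_upper_sum a b \<alpha> f m y \<le> step_sum a b \<alpha> (best_fit_upper f n x) m y d"
    using d best_fit_bounds(2)[OF assms(1) f] by (rule ross_upper_sum_le)
  also have "\<dots> \<le> ross_upper_sum a b \<alpha> f n x"
    unfolding best_fit_sum(1)[symmetric] by (rule step_sum_mono[OF d best_fit_step(1)[OF assms(1)]]) simp
  finally show ?thesis .
qed

lemma ross_lower_sum_refine:
  assumes "is_partition a b n x" and "is_partition a b m y" and "x ` {..n} \<subseteq> y ` {..m}"
  shows "ross_lower_sum a b \<alpha> f n x \<le> ross_lower_sum a b \<alpha> f m y"
proof -
  obtain d where d: "step_wrt a b (best_fit_lower f n x) m y d"
    using step_wrt_refine[OF best_fit_step(2) assms(2,3)] assms(1) by blast
  have "ross_lower_sum a b \<alpha> f n x \<le> step_sum a b \<alpha> (best_fit_lower f n x) m y d"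
    unfolding best_fit_sum(2)[symmetric] by (rule step_sum_mono[OF best_fit_step(2)[OF assms(1)] d]) simp
  also have "\<dots> \<le> ross_lower_sum a b \<alpha> f m y"
    using d best_fit_bounds(1)[OF assms(1) f] by (rule ross_lower_sum_ge)
  finally show ?thesis .
qed

text \<open>The lower best fit for x lies below f and the upper best fit for y above it; the step
  integrals inherit this order.\<close>

lemma ross_lower_sum_le_upper_sum:
  assumes x: "is_partition a b n x" and y: "is_partition a b m y"
  shows "ross_lower_sum a b \<alpha> f n x \<le> ross_upper_sum a b \<alpha> f m y"
  unfolding best_fit_sum(1,2)[symmetric]
  using best_fit_bounds[OF x f] best_fit_bounds[OF y f]
  by (intro step_sum_mono[OF best_fit_step(2)[OF x] best_fit_step(1)[OF y]]) (meson order_trans)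

text \<open>Witnesses that the sets of Ross's sums are nonempty; its lower and upper sums also bound
  all upper and lower sums.\<close>

lemma trivial_partition: "is_partition a b 1 (\<lambda>i. if i = 0 then a else b)"
  using ab by (simp add: is_partition_def)

text \<open>Ross's upper sums are among the integrals of step functions above f, and each such
  integral dominates one of Ross's sums. The two sets thus have the same infimum.\<close>

lemma rds_upper_eq_ross_upper: "rds_upper a b \<alpha> f = ross_upper a b \<alpha> f"
proof -
  let ?S = "{step_integral a b \<alpha> u | u. step_function a b u \<and> (\<forall>t\<in>{a..b}. f t \<le> u t)}"
  let ?R = "{ross_upper_sum a b \<alpha> f n x | n x. is_partition a b n x}"
  have R_S: "?R \<subseteq> ?S"
  proof clarify
    fix n x assume x: "is_partition a b n x"
    then show "\<exists>u. ross_upper_sum a b \<alpha> f n x = step_integral a b \<alpha> u \<and>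
        step_function a b u \<and> (\<forall>t\<in>{a..b}. f t \<le> u t)"
      using step_integral_eq[OF best_fit_step(1)[OF x]] step_wrt_step_function[OF best_fit_step(1)[OF x]]
        best_fit_bounds(2)[OF x f] by (intro exI[of _ "best_fit_upper f n x"]) (auto simp: best_fit_sum)
  qed
  have S_R: "\<exists>r\<in>?R. r \<le> s" if "s \<in> ?S" for s
  proof -
    obtain u n x c where u: "s = step_integral a b \<alpha> u" "step_wrt a b u n x c" "\<forall>t\<in>{a..b}. f t \<le> u t"
      using \<open>s \<in> ?S\<close> by (auto simp: step_function_def)
    then have "ross_upper_sum a b \<alpha> f n x \<le> s"
      using ross_upper_sum_le step_integral_eq by simp
    moreover have "is_partition a b n x" using u(2) by (simp add: step_wrt_def)
    ultimately show ?thesis by auto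
  qed
  have bdd_R: "bdd_below ?R"
    using ross_lower_sum_le_upper_sum[OF trivial_partition] by (auto intro!: bdd_belowI)
  have R: "?R \<noteq> {}" using trivial_partition by auto
  then have S: "?S \<noteq> {}" using R_S by blast
  \<comment> \<open>A lower bound of \<open>?R\<close> also bounds \<open>?S\<close>, since every
    element of \<open>?S\<close> lies above some element of \<open>?R\<close>.\<close>
  have bdd_S: "bdd_below ?S"
    using bdd_R S_R by (meson bdd_below_def order_trans)
  show ?thesis
    unfolding rds_upper_def ross_upper_def
  proof (rule antisym)
    show "Inf ?S \<le> Inf ?R" by (rule cInf_superset_mono[OF R bdd_S R_S])
    show "Inf ?R \<le> Inf ?S" by (rule cInf_mono[OF S bdd_R S_R])
  qed
qed

text \<open>Dual argument, with lower best fits and suprema.\<close>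

lemma rds_lower_eq_ross_lower: "rds_lower a b \<alpha> f = ross_lower a b \<alpha> f"
proof -
  let ?S = "{step_integral a b \<alpha> v | v. step_function a b v \<and> (\<forall>t\<in>{a..b}. v t \<le> f t)}"
  let ?R = "{ross_lower_sum a b \<alpha> f n x | n x. is_partition a b n x}"
  have R_S: "?R \<subseteq> ?S"
  proof clarify
    fix n x assume x: "is_partition a b n x"
    then show "\<exists>v. ross_lower_sum a b \<alpha> f n x = step_integral a b \<alpha> v \<and>
        step_function a b v \<and> (\<forall>t\<in>{a..b}. v t \<le> f t)"
      using step_integral_eq[OF best_fit_step(2)[OF x]] step_wrt_step_function[OF best_fit_step(2)[OF x]]
        best_fit_bounds(1)[OF x f] by (intro exI[of _ "best_fit_lower f n x"]) (auto simp: best_fit_sum)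
  qed
  have S_R: "\<exists>r\<in>?R. s \<le> r" if "s \<in> ?S" for s
  proof -
    obtain v n x c where v: "s = step_integral a b \<alpha> v" "step_wrt a b v n x c" "\<forall>t\<in>{a..b}. v t \<le> f t"
      using \<open>s \<in> ?S\<close> by (auto simp: step_function_def)
    then have "s \<le> ross_lower_sum a b \<alpha> f n x"
      using ross_lower_sum_ge step_integral_eq by simp
    moreover have "is_partition a b n x" using v(2) by (simp add: step_wrt_def)
    ultimately show ?thesis by auto
  qed
  have bdd_R: "bdd_above ?R"
    using ross_lower_sum_le_upper_sum[OF _ trivial_partition] by (auto intro!: bdd_aboveI)
  have R: "?R \<noteq> {}" using trivial_partition by auto
  then have S: "?S \<noteq> {}" using R_S by blast
  have bdd_S: "bdd_above ?S"
    using bdd_R S_R by (meson bdd_above_def order_trans)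
  show ?thesis
    unfolding rds_lower_def ross_lower_def
  proof (rule antisym)
    show "Sup ?S \<le> Sup ?R" by (rule cSup_mono[OF S bdd_R S_R])
    show "Sup ?R \<le> Sup ?S" by (rule cSup_subset_mono[OF R bdd_S R_S])
  qed
qed

lemma ross_upper_le:
  assumes "is_partition a b n x"
  shows "ross_upper a b \<alpha> f \<le> ross_upper_sum a b \<alpha> f n x"
  unfolding ross_upper_def using assms ross_lower_sum_le_upper_sum[OF trivial_partition]
  by (intro cInf_lower) (auto intro!: bdd_belowI)

lemma ross_lower_ge:
  assumes "is_partition a b n x"
  shows "ross_lower_sum a b \<alpha> f n x \<le> ross_lower a b \<alpha> f"
  unfolding ross_lower_def using assms ross_lower_sum_le_upper_sum[OF _ trivial_partition]
  by (intro cSup_upper) (auto intro!: bdd_aboveI)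

lemma ross_lower_le_upper: "ross_lower a b \<alpha> f \<le> ross_upper a b \<alpha> f"
  unfolding ross_lower_def ross_upper_def using trivial_partition ross_lower_sum_le_upper_sum
  by (intro cSup_least cInf_greatest) blast+

lemma ross_integrable_iff:
  "ross_integrable a b \<alpha> f \<longleftrightarrow>
    (\<forall>\<epsilon>>0. \<exists>n x. is_partition a b n x \<and>
       ross_upper_sum a b \<alpha> f n x - ross_lower_sum a b \<alpha> f n x < \<epsilon>)"
proof
  assume int: "ross_integrable a b \<alpha> f"
  show "\<forall>\<epsilon>>0. \<exists>n x. is_partition a b n x \<and>
      ross_upper_sum a b \<alpha> f n x - ross_lower_sum a b \<alpha> f n x < \<epsilon>"
  proof (intro allI impI)
    fix \<epsilon> :: real assume "0 < \<epsilon>"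
    \<comment> \<open>The upper and lower sums are each brought within half of \<epsilon> of the
      common value, by partitions that may differ.\<close>
    have "\<exists>r\<in>{ross_upper_sum a b \<alpha> f n x | n x. is_partition a b n x}. r < ross_upper a b \<alpha> f + \<epsilon> / 2"
      unfolding ross_upper_def using trivial_partition \<open>0 < \<epsilon>\<close> by (intro cInf_lessD) auto
    then obtain n x where x: "is_partition a b n x"
        "ross_upper_sum a b \<alpha> f n x < ross_upper a b \<alpha> f + \<epsilon> / 2" by auto
    have "\<exists>r\<in>{ross_lower_sum a b \<alpha> f n x | n x. is_partition a b n x}. ross_lower a b \<alpha> f - \<epsilon> / 2 < r"
      unfolding ross_lower_def using trivial_partition \<open>0 < \<epsilon>\<close> by (intro less_cSupD) auto
    then obtain m y where y: "is_partition a b m y"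
        "ross_lower a b \<alpha> f - \<epsilon> / 2 < ross_lower_sum a b \<alpha> f m y" by auto
    \<comment> \<open>Refinement spoils neither estimate, so both hold for one partition z.\<close>
    obtain k z where z: "is_partition a b k z" "x ` {..n} \<subseteq> z ` {..k}" "y ` {..m} \<subseteq> z ` {..k}"
      using common_refinement[OF x(1) y(1)] by blast
    have "ross_upper_sum a b \<alpha> f k z - ross_lower_sum a b \<alpha> f k z < \<epsilon>"
      using ross_upper_sum_refine[OF x(1) z(1,2)] ross_lower_sum_refine[OF y(1) z(1,3)] x(2) y(2) int
      by (simp add: ross_integrable_def)
    then show "\<exists>n x. is_partition a b n x \<and>
        ross_upper_sum a b \<alpha> f n x - ross_lower_sum a b \<alpha> f n x < \<epsilon>"
      using z(1) by blast
  qed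
next
  assume small: "\<forall>\<epsilon>>0. \<exists>n x. is_partition a b n x \<and>
      ross_upper_sum a b \<alpha> f n x - ross_lower_sum a b \<alpha> f n x < \<epsilon>"
  \<comment> \<open>For a partition with gap below \<epsilon>, its upper sum bounds
    \<open>ross_upper\<close> from above and its lower sum bounds \<open>ross_lower\<close> from
    below.\<close>
  have "ross_upper a b \<alpha> f \<le> ross_lower a b \<alpha> f + \<epsilon>" if "0 < \<epsilon>" for \<epsilon>
    using small that ross_upper_le ross_lower_ge by (smt (verit))
  then have "ross_upper a b \<alpha> f \<le> ross_lower a b \<alpha> f" by (rule field_le_epsilon)
  then show "ross_integrable a b \<alpha> f"
    using ross_lower_le_upper by (simp add: ross_integrable_def)
qed

end

end

theorem corollary4p8:
  fixes a b :: real and \<alpha> f :: "real \<Rightarrow> real"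
  assumes "a < b"
    and "mono_on {a..b} \<alpha>"
    and "bounded (f ` {a..b})"
  shows "(rds_integrable a b \<alpha> f \<longleftrightarrow>
            (\<forall>\<epsilon>>0. \<exists>n x. is_partition a b n x \<and>
               ross_upper_sum a b \<alpha> f n x - ross_lower_sum a b \<alpha> f n x =
                 step_integral a b \<alpha> (\<lambda>t. best_fit_upper f n x t - best_fit_lower f n x t) \<and>
               step_integral a b \<alpha> (\<lambda>t. best_fit_upper f n x t - best_fit_lower f n x t) < \<epsilon>))
         \<and> (rds_integrable a b \<alpha> f \<longleftrightarrow> ross_integrable a b \<alpha> f)
         \<and> (rds_integrable a b \<alpha> f \<longrightarrow> rds_integral a b \<alpha> f = ross_integral a b \<alpha> f)"
proof -
  \<comment> \<open>The equation with the step integral holds for every partition, so the criterion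
    reduces to a bound on the gap between Ross's sums.\<close>
  have fit: "is_partition a b n x \<and>
      ross_upper_sum a b \<alpha> f n x - ross_lower_sum a b \<alpha> f n x =
        step_integral a b \<alpha> (\<lambda>t. best_fit_upper f n x t - best_fit_lower f n x t) \<and>
      step_integral a b \<alpha> (\<lambda>t. best_fit_upper f n x t - best_fit_lower f n x t) < \<epsilon> \<longleftrightarrow>
      is_partition a b n x \<and> ross_upper_sum a b \<alpha> f n x - ross_lower_sum a b \<alpha> f n x < \<epsilon>" for n x \<epsilon>
    using step_integral_eq[OF assms(1,2) best_fit_step(3)] by (auto simp: best_fit_sum)
  have rds: "rds_integrable a b \<alpha> f \<longleftrightarrow> ross_integrable a b \<alpha> f"
    by (auto simp: rds_integrable_def ross_integrable_def rds_upper_eq_ross_upper[OF assms]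
        rds_lower_eq_ross_lower[OF assms])
  \<comment> \<open>\<open>rds_integral\<close> is the lower value and \<open>ross_integral\<close>
    the upper one; integrability identifies them.\<close>
  have "rds_integral a b \<alpha> f = ross_integral a b \<alpha> f" if "ross_integrable a b \<alpha> f"
    using that by (simp add: rds_integral_def ross_integral_def ross_integrable_def
        rds_lower_eq_ross_lower[OF assms])
  then show ?thesis
    unfolding rds fit ross_integrable_iff[OF assms, symmetric] by simp
qed

end
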